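(* Let $R$ be an associative ring with identity, $R^{\mathrm{op}}$ its opposite ring, and $n\ge 1$. The map $$[B\,|\,A]\;\mapsto\;[B\,|\,A]^*:=\left[\begin{array}{c|c} B^{\mathrm{tr}} & \mathbf 0\\ A^{\mathrm{tr}} & I_n\end{array}\right]$$ is an anti-isomorphism between the partial orders $L_n(R)$ and $L_n(R^{\mathrm{op}})$ (that is, a well-defined order-reversing bijection whose inverse is also order-reversing).
   Context: For an associative, not necessarily commutative, ring $R$ with identity and $n\ge 1$, $L'_n(R)$ is the collection of pairs $(B\,|\,A)$ of matrices with entries in $R$ such that $A$ has $n$ columns and $B$ has the same number of rows as $A$ (the number of rows, and the number of columns of $B$, are arbitrary). The relation $(B\,|\,A)\le_n (B'\,|\,A')$ holds in $L'_n(R)$ if there exist matrices $U,V,G$ over $R$, of appropriate size, such that $UB=B'V$ and $UA=A'+B'G$. This is a pre-order; write $(B\,|\,A)\approx_n(B'\,|\,A')$ if both $(B\,|\,A)\le_n(B'\,|\,A')$ and $(B'\,|\,A')\le_n(B\,|\,A)$. $L_n(R)$ is the set of equivalence classes $[B\,|\,A]$ of $\approx_n$, with the induced partial order. $R^{\mathrm{op}}$ has the same additive group as $R$ and multiplication $r*s=sr$. $A^{\mathrm{tr}}$ is the transpose, regarded as a matrix over $R^{\mathrm{op}}$; $I_n$ is the $n\times n$ identity matrix; $\mathbf 0$ is a zero matrix of the appropriate size. *)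

theory Defs
  imports "Jordan_Normal_Form.Matrix"
begin

(* Rings are types of sort {ring, monoid_mult}: associative with identity, not
   necessarily commutative. The class ring_1 would in addition demand 0 ~= 1. *)

typedef 'a opp = "UNIV :: 'a set"
  morphisms unopp opp ..

setup_lifting type_definition_opp

instantiation opp :: ("{ring, monoid_mult}") "{ring, monoid_mult}"
begin

lift_definition zero_opp :: "'a opp" is 0 .
lift_definition one_opp :: "'a opp" is 1 .
lift_definition plus_opp :: "'a opp \<Rightarrow> 'a opp \<Rightarrow> 'a opp" is "(+)" .
lift_definition minus_opp :: "'a opp \<Rightarrow> 'a opp \<Rightarrow> 'a opp" is "(-)" .
lift_definition uminus_opp :: "'a opp \<Rightarrow> 'a opp" is uminus .
lift_definition times_opp :: "'a opp \<Rightarrow> 'a opp \<Rightarrow> 'a opp" is "\<lambda>r s. s * r" .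

instance
  by standard (transfer; simp add: algebra_simps)+

end

definition transpose_opp :: "'a mat \<Rightarrow> 'a opp mat" where
  "transpose_opp M = map_mat opp (transpose_mat M)"

(* The matrix pair (B | A) is represented by the Isabelle pair (B, A).
   Zero rows, or zero columns of B, are allowed. *)

definition mat_pairs :: "nat \<Rightarrow> ('a mat \<times> 'a mat) set" where
  "mat_pairs n = {(B, A). dim_col A = n \<and> dim_row B = dim_row A}"

definition pair_le :: "nat \<Rightarrow> ('a::{ring, monoid_mult} mat \<times> 'a mat) rel" where
  "pair_le n = {((B, A), (B', A')).
     (B, A) \<in> mat_pairs n \<and> (B', A') \<in> mat_pairs n \<and>
     (\<exists>U \<in> carrier_mat (dim_row B') (dim_row B).
      \<exists>V \<in> carrier_mat (dim_col B') (dim_col B).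
      \<exists>G \<in> carrier_mat (dim_col B') n.
        U * B = B' * V \<and> U * A = A' + B' * G)}"

definition pair_equiv :: "nat \<Rightarrow> ('a::{ring, monoid_mult} mat \<times> 'a mat) rel" where
  "pair_equiv n = pair_le n \<inter> (pair_le n)\<inverse>"

definition pair_class ::
    "nat \<Rightarrow> 'a::{ring, monoid_mult} mat \<times> 'a mat \<Rightarrow> ('a mat \<times> 'a mat) set" where
  "pair_class n p = pair_equiv n `` {p}"

definition L :: "nat \<Rightarrow> ('a::{ring, monoid_mult} mat \<times> 'a mat) set set" where
  "L n = mat_pairs n // pair_equiv n"

definition L_le :: "nat \<Rightarrow> ('a::{ring, monoid_mult} mat \<times> 'a mat) set rel" where
  "L_le n = {(X, Y). X \<in> L n \<and> Y \<in> L n \<and> (\<exists>p\<in>X. \<exists>q\<in>Y. (p, q) \<in> pair_le n)}"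

fun dual_pair ::
    "nat \<Rightarrow> 'a::{ring, monoid_mult} mat \<times> 'a mat \<Rightarrow> 'a opp mat \<times> 'a opp mat" where
  "dual_pair n (B, A) =
     (transpose_opp B @\<^sub>r transpose_opp A, 0\<^sub>m (dim_col B) n @\<^sub>r 1\<^sub>m n)"

(* The union over all representatives is a single class exactly because the
   construction respects the equivalence, which is part of the theorem. *)

definition dual_class ::
    "nat \<Rightarrow> ('a::{ring, monoid_mult} mat \<times> 'a mat) set \<Rightarrow> ('a opp mat \<times> 'a opp mat) set" where
  "dual_class n X = (\<Union>p\<in>X. pair_class n (dual_pair n p))"

definition order_anti_isomorphism ::
    "'a set \<Rightarrow> 'a rel \<Rightarrow> 'b set \<Rightarrow> 'b rel \<Rightarrow> ('a \<Rightarrow> 'b) \<Rightarrow> bool" where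
  "order_anti_isomorphism P r Q s f \<longleftrightarrow>
     partial_order_on P r \<and> partial_order_on Q s \<and> bij_betw f P Q \<and>
     (\<forall>x\<in>P. \<forall>y\<in>P. (x, y) \<in> r \<longrightarrow> (f y, f x) \<in> s) \<and>
     (\<forall>u\<in>Q. \<forall>v\<in>Q. (u, v) \<in> s \<longrightarrow> (inv_into P f v, inv_into P f u) \<in> r)"

end

theory Submission
  imports Defs
begin

text \<open>
  Write \<open>(B A)\<close> for two matrices side by side. After transposing back to \<open>R\<close>, the relation
  \<open>(B' | A')\<^sup>* \<le> (B | A)\<^sup>*\<close> over the opposite ring says that there are matrices
  \<open>X\<close>, \<open>Y\<close>, \<open>Z\<close> over \<open>R\<close> with \<open>(B' A') X = Y (B A)\<close> and \<open>(0 I) X = (0 I) + Z (B A)\<close>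
  (\<open>pair_le_transpose_opp_iff\<close>). Cut \<open>X\<close> into the blocks \<open>P\<close>, \<open>Q\<close> above and \<open>S\<close>, \<open>T\<close>
  below. The second equation determines the lower blocks, \<open>S = Z B\<close> and \<open>T = I + Z A\<close>, and the
  first one becomes
  \<open>B' P + A' Z B = Y B\<close> and \<open>B' Q + A' + A' Z A = Y A\<close>.
  With \<open>U = Y - A' Z\<close> this is \<open>U B = B' P\<close> and \<open>U A = A' + B' Q\<close>, that is,
  \<open>(B | A) \<le> (B' | A')\<close>. Conversely, \<open>Z = 0\<close> turns matrices \<open>U\<close>, \<open>V\<close>, \<open>G\<close> for
  \<open>(B | A) \<le> (B' | A')\<close> into a solution, with \<open>Y = U\<close> and
  \<open>X\<close> made of the rows \<open>(V G)\<close> and \<open>(0 I)\<close>. Hence \<open>p \<mapsto> p\<^sup>*\<close> both reverses the pre-order and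
  reflects it (\<open>dual_pair_le_iff\<close>), which gives well-definedness and injectivity on classes.

  For surjectivity, a pair \<open>(D | C)\<close> over the opposite ring is transposed to \<open>R\<close> and dualised
  there by the same recipe. The dual of the result is the pair with the rows \<open>(D C | 0)\<close> and
  \<open>(0 I | I)\<close>. Clearing its last rows with the help of the identity block shows that it is equivalent to
  \<open>(D | C)\<close> (\<open>four_block_pair_equiv\<close>). The rest is the passage from a pre-order to the
  partial order on its classes.
\<close>

section \<open>Matrices over a ring with identity\<close>

text \<open>
  The zero ring is a legitimate ring of coefficients, so the identity laws have a sort below
  \<open>semiring_1\<close>, which demands \<open>0 \<noteq> 1\<close>.
\<close>

lemma mult_one_mat_left:
  fixes A :: "'a::{ring, monoid_mult} mat"
  assumes "A \<in> carrier_mat m k"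
  shows "1\<^sub>m m * A = A"
proof (rule eq_matI)
  fix i j assume ij: "i < dim_row A" "j < dim_col A"
  have "(1\<^sub>m m * A) $$ (i, j) = (\<Sum>l = 0..<m. (if i = l then 1 else 0) * A $$ (l, j))"
    using ij assms by (simp add: scalar_prod_def)
  also have "\<dots> = (\<Sum>l = 0..<m. (if l = i then A $$ (l, j) else 0))"
    by (rule sum.cong) auto
  finally show "(1\<^sub>m m * A) $$ (i, j) = A $$ (i, j)"
    using ij assms by simp
qed (use assms in auto)

lemma mult_one_mat_right:
  fixes A :: "'a::{ring, monoid_mult} mat"
  assumes "A \<in> carrier_mat m k"
  shows "A * 1\<^sub>m k = A"
proof (rule eq_matI)
  fix i j assume ij: "i < dim_row A" "j < dim_col A"
  have "(A * 1\<^sub>m k) $$ (i, j) = (\<Sum>l = 0..<k. A $$ (i, l) * (if l = j then 1 else 0))"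
    using ij assms by (simp add: scalar_prod_def)
  also have "\<dots> = (\<Sum>l = 0..<k. (if l = j then A $$ (i, l) else 0))"
    by (rule sum.cong) auto
  finally show "(A * 1\<^sub>m k) $$ (i, j) = A $$ (i, j)"
    using ij assms by simp
qed (use assms in auto)

text \<open>
  Side-by-side composition, with empty lower blocks so that the block calculus of
  \<open>four_block_mat\<close> applies.
\<close>

definition append_cols :: "'a::zero mat \<Rightarrow> 'a mat \<Rightarrow> 'a mat" (infixr "\<oplus>\<^sub>c" 65) where
  "A \<oplus>\<^sub>c B = four_block_mat A B (0\<^sub>m 0 (dim_col A)) (0\<^sub>m 0 (dim_col B))"

lemma append_cols_carrier:
  "A \<in> carrier_mat m k \<Longrightarrow> B \<in> carrier_mat m l \<Longrightarrow> A \<oplus>\<^sub>c B \<in> carrier_mat m (k + l)"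
  by (auto simp: append_cols_def)

lemma append_cols_inject:
  assumes "A \<in> carrier_mat m k" "B \<in> carrier_mat m l"
    and "A' \<in> carrier_mat m k" "B' \<in> carrier_mat m l"
  shows "A \<oplus>\<^sub>c B = A' \<oplus>\<^sub>c B' \<longleftrightarrow> A = A' \<and> B = B'"
proof
  assume eq: "A \<oplus>\<^sub>c B = A' \<oplus>\<^sub>c B'"
  have "A $$ (i, j) = A' $$ (i, j)" if "i < m" "j < k" for i j
    using arg_cong[OF eq, of "\<lambda>M. M $$ (i, j)"] assms that by (simp add: append_cols_def)
  moreover have "B $$ (i, j) = B' $$ (i, j)" if "i < m" "j < l" for i j
    using arg_cong[OF eq, of "\<lambda>M. M $$ (i, k + j)"] assms that by (simp add: append_cols_def)
  ultimately show "A = A' \<and> B = B'"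
    using assms by (auto intro!: eq_matI)
qed simp

lemma mult_append_cols:
  fixes Y :: "'a::ring mat"
  assumes "Y \<in> carrier_mat m' m" "A \<in> carrier_mat m k" "B \<in> carrier_mat m l"
  shows "Y * (A \<oplus>\<^sub>c B) = (Y * A) \<oplus>\<^sub>c (Y * B)"
proof (rule eq_matI)
  fix i j assume "i < dim_row (Y * A \<oplus>\<^sub>c Y * B)" "j < dim_col (Y * A \<oplus>\<^sub>c Y * B)"
  then have "i < m'" "j < k + l" using assms by (auto simp: append_cols_def)
  moreover have "col (A \<oplus>\<^sub>c B) j = (if j < k then col A j else col B (j - k))"
    using assms \<open>j < k + l\<close> by (intro eq_vecI) (auto simp: append_cols_def)
  ultimately show "(Y * (A \<oplus>\<^sub>c B)) $$ (i, j) = (Y * A \<oplus>\<^sub>c Y * B) $$ (i, j)"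
    using assms by (auto simp: append_cols_def)
qed (use assms in \<open>auto simp: append_cols_def\<close>)

lemma append_cols_add:
  fixes A :: "'a::ring mat"
  assumes "A \<in> carrier_mat m k" "B \<in> carrier_mat m l"
    and "A' \<in> carrier_mat m k" "B' \<in> carrier_mat m l"
  shows "(A \<oplus>\<^sub>c B) + (A' \<oplus>\<^sub>c B') = (A + A') \<oplus>\<^sub>c (B + B')"
  using assms by (intro eq_matI) (auto simp: append_cols_def)

lemma append_cols_mult_four_block:
  fixes A :: "'a::ring mat"
  assumes "A \<in> carrier_mat m k" "B \<in> carrier_mat m l"
    and "P \<in> carrier_mat k k'" "Q \<in> carrier_mat k l'"
    and "S \<in> carrier_mat l k'" "T \<in> carrier_mat l l'"
  shows "(A \<oplus>\<^sub>c B) * four_block_mat P Q S T = (A * P + B * S) \<oplus>\<^sub>c (A * Q + B * T)"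
proof -
  have d: "dim_col A = k" "dim_col B = l" using assms by auto
  show ?thesis unfolding append_cols_def d
    by (subst mult_four_block_mat[of _ m k _ l _ 0 _ _ k' _ l']) (use assms in auto)
qed

lemma append_rows_mult:
  fixes A :: "'a::ring mat"
  assumes "A \<in> carrier_mat k m" "B \<in> carrier_mat l m" "X \<in> carrier_mat m m'"
  shows "(A @\<^sub>r B) * X = (A * X) @\<^sub>r (B * X)"
proof (rule eq_matI)
  fix i j assume "i < dim_row (A * X @\<^sub>r B * X)" "j < dim_col (A * X @\<^sub>r B * X)"
  then have "i < k + l" "j < m'" using assms by (auto simp: append_rows_def)
  moreover have "row (A @\<^sub>r B) i = (if i < k then row A i else row B (i - k))"
    using assms \<open>i < k + l\<close> by (intro eq_vecI) (auto simp: append_rows_def)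
  ultimately show "((A @\<^sub>r B) * X) $$ (i, j) = (A * X @\<^sub>r B * X) $$ (i, j)"
    using assms by (auto simp: append_rows_def)
qed (use assms in \<open>auto simp: append_rows_def\<close>)

lemma append_rows_add:
  fixes A :: "'a::ring mat"
  assumes "A \<in> carrier_mat k m" "B \<in> carrier_mat l m"
    and "A' \<in> carrier_mat k m" "B' \<in> carrier_mat l m"
  shows "(A @\<^sub>r B) + (A' @\<^sub>r B') = (A + A') @\<^sub>r (B + B')"
  using assms by (intro eq_matI) (auto simp: append_rows_def)

lemma append_cols_append_rows:
  assumes "A \<in> carrier_mat m k" "B \<in> carrier_mat m l"
    and "C \<in> carrier_mat m' k" "D \<in> carrier_mat m' l"
  shows "(A \<oplus>\<^sub>c B) @\<^sub>r (C \<oplus>\<^sub>c D) = four_block_mat A B C D"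
  using assms by (intro eq_matI) (auto simp: append_cols_def append_rows_def)

lemma append_cols_mult_append_rows:
  fixes A :: "'a::ring mat"
  assumes "A \<in> carrier_mat m k" "B \<in> carrier_mat m l"
    and "P \<in> carrier_mat k k'" "Q \<in> carrier_mat l k'"
  shows "(A \<oplus>\<^sub>c B) * (P @\<^sub>r Q) = A * P + B * Q"
proof -
  have d: "dim_col A = k" "dim_col B = l" "dim_row P = k" "dim_row Q = l" using assms by auto
  show ?thesis unfolding append_cols_def append_rows_def d
    by (subst mult_four_block_mat[of _ m k _ l _ 0 _ _ k' _ 0]) (use assms in \<open>auto intro!: eq_matI\<close>)
qed

lemma four_block_mult_append_rows:
  fixes A :: "'a::ring mat"
  assumes A: "A \<in> carrier_mat m k" "B \<in> carrier_mat m l"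
    and C: "C \<in> carrier_mat m' k" "D \<in> carrier_mat m' l"
    and P: "P \<in> carrier_mat k k'" "Q \<in> carrier_mat l k'"
  shows "four_block_mat A B C D * (P @\<^sub>r Q) = (A * P + B * Q) @\<^sub>r (C * P + D * Q)"
proof -
  have "P @\<^sub>r Q \<in> carrier_mat (k + l) k'" using P by simp
  then have "((A \<oplus>\<^sub>c B) @\<^sub>r (C \<oplus>\<^sub>c D)) * (P @\<^sub>r Q) =
      ((A \<oplus>\<^sub>c B) * (P @\<^sub>r Q)) @\<^sub>r ((C \<oplus>\<^sub>c D) * (P @\<^sub>r Q))"
    by (intro append_rows_mult) (use A C in \<open>auto intro: append_cols_carrier\<close>)
  then show ?thesis
    unfolding append_cols_append_rows[OF A C] append_cols_mult_append_rows[OF A P]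
      append_cols_mult_append_rows[OF C P] .
qed

section \<open>Transposition into the opposite ring\<close>

lemma opp_sum: "opp (\<Sum>i\<in>I. f i) = (\<Sum>i\<in>I. opp (f i :: 'a::{ring, monoid_mult}))"
proof (induction I rule: infinite_finite_induct)
  case (insert i I)
  have "opp (f i + sum f I) = opp (f i) + opp (sum f I)"
    by (simp add: plus_opp_def opp_inverse)
  with insert show ?case by simp
qed (simp_all add: zero_opp_def)

lemma transpose_opp_carrier [simp]:
  "transpose_opp M \<in> carrier_mat m k \<longleftrightarrow> M \<in> carrier_mat k m"
  by (auto simp: transpose_opp_def)

lemma transpose_opp_mult:
  fixes M :: "'a::{ring, monoid_mult} mat"
  assumes "M \<in> carrier_mat m k" "N \<in> carrier_mat k l"
  shows "transpose_opp (M * N) = transpose_opp N * transpose_opp M"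
  using assms
  by (intro eq_matI)
    (auto simp: transpose_opp_def scalar_prod_def opp_sum times_opp_def opp_inverse intro!: sum.cong)

lemma transpose_opp_add:
  fixes M :: "'a::{ring, monoid_mult} mat"
  assumes "M \<in> carrier_mat m k" "N \<in> carrier_mat m k"
  shows "transpose_opp (M + N) = transpose_opp M + transpose_opp N"
  using assms by (intro eq_matI) (auto simp: transpose_opp_def plus_opp_def opp_inverse)

lemma transpose_opp_inject [simp]:
  "transpose_opp M = transpose_opp N \<longleftrightarrow> M = N"
proof
  assume eq: "transpose_opp M = transpose_opp N"
  have "dim_row M = dim_row N" "dim_col M = dim_col N"
    using arg_cong[OF eq, of dim_col] arg_cong[OF eq, of dim_row] by (auto simp: transpose_opp_def)
  moreover have "M $$ (i, j) = N $$ (i, j)" if "i < dim_row N" "j < dim_col N" for i j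
    using arg_cong[OF eq, of "\<lambda>K. K $$ (j, i)"] that calculation
    by (simp add: transpose_opp_def opp_inject)
  ultimately show "M = N" by (intro eq_matI) auto
qed simp

lemma transpose_opp_surj: "\<exists>M. N = transpose_opp M"
proof
  show "N = transpose_opp (map_mat unopp (transpose_mat N))"
    by (intro eq_matI) (auto simp: transpose_opp_def unopp_inverse)
qed

text \<open>
  Every matrix over the opposite ring is a transpose, so an existential statement about matrices
  over the opposite ring can be read over the ring itself.
\<close>

lemma bex_transpose_opp:
  "(\<exists>N \<in> carrier_mat m k. P N) \<longleftrightarrow> (\<exists>M \<in> carrier_mat k m. P (transpose_opp M))"
proof
  assume "\<exists>N \<in> carrier_mat m k. P N"
  then obtain N where N: "N \<in> carrier_mat m k" "P N" by blast
  moreover obtain M where "N = transpose_opp M" using transpose_opp_surj by blast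
  ultimately show "\<exists>M \<in> carrier_mat k m. P (transpose_opp M)" by auto
qed auto

lemma transpose_opp_append_cols:
  fixes A :: "'a::{ring, monoid_mult} mat"
  assumes "A \<in> carrier_mat m k" "B \<in> carrier_mat m l"
  shows "transpose_opp (A \<oplus>\<^sub>c B) = transpose_opp A @\<^sub>r transpose_opp B"
  using assms by (intro eq_matI) (auto simp: transpose_opp_def append_cols_def append_rows_def)

lemma transpose_opp_append_rows:
  fixes A :: "'a::{ring, monoid_mult} mat"
  assumes "A \<in> carrier_mat k m" "B \<in> carrier_mat l m"
  shows "transpose_opp (A @\<^sub>r B) = transpose_opp A \<oplus>\<^sub>c transpose_opp B"
  using assms by (intro eq_matI) (auto simp: transpose_opp_def append_cols_def append_rows_def)

lemma transpose_opp_zero [simp]: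
  "transpose_opp (0\<^sub>m m k :: 'a::{ring, monoid_mult} mat) = 0\<^sub>m k m"
  by (intro eq_matI) (auto simp: transpose_opp_def zero_opp_def)

lemma transpose_opp_one [simp]:
  "transpose_opp (1\<^sub>m m :: 'a::{ring, monoid_mult} mat) = 1\<^sub>m m"
  by (intro eq_matI) (auto simp: transpose_opp_def zero_opp_def one_opp_def)

section \<open>The pre-order on pairs\<close>

lemma mat_pairsI:
  "B \<in> carrier_mat r c \<Longrightarrow> A \<in> carrier_mat r n \<Longrightarrow> (B, A) \<in> mat_pairs n"
  by (simp add: mat_pairs_def)

lemma mat_pairsE:
  assumes "p \<in> mat_pairs n"
  obtains B A r c where "p = (B, A)" "B \<in> carrier_mat r c" "A \<in> carrier_mat r n"
proof (cases p)
  case (Pair B A)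
  have d: "dim_col A = n" "dim_row B = dim_row A"
    using assms unfolding Pair mat_pairs_def by simp_all
  have 1: "B \<in> carrier_mat (dim_row A) (dim_col B)" by (rule carrier_matI[OF d(2) refl])
  have 2: "A \<in> carrier_mat (dim_row A) n" by (rule carrier_matI[OF refl d(1)])
  show thesis by (rule that[OF Pair 1 2])
qed

lemma pair_le_iff:
  fixes A :: "'a::{ring, monoid_mult} mat"
  assumes "B \<in> carrier_mat r c" "A \<in> carrier_mat r n"
    and "B' \<in> carrier_mat r' c'" "A' \<in> carrier_mat r' n"
  shows "((B, A), (B', A')) \<in> pair_le n \<longleftrightarrow>
    (\<exists>U \<in> carrier_mat r' r. \<exists>V \<in> carrier_mat c' c. \<exists>G \<in> carrier_mat c' n.
      U * B = B' * V \<and> U * A = A' + B' * G)"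
proof -
  have "dim_row B = r" "dim_col B = c" "dim_row A = r" "dim_col A = n"
    "dim_row B' = r'" "dim_col B' = c'" "dim_row A' = r'" "dim_col A' = n"
    using assms by auto
  then show ?thesis
    unfolding pair_le_def mat_pairs_def by simp
qed

lemma pair_le_mat_pairs:
  assumes "(p, q) \<in> pair_le n"
  shows "p \<in> mat_pairs n" "q \<in> mat_pairs n"
  using assms by (auto simp: pair_le_def)

lemma pair_le_refl:
  fixes p :: "'a::{ring, monoid_mult} mat \<times> 'a mat"
  assumes "p \<in> mat_pairs n"
  shows "(p, p) \<in> pair_le n"
proof -
  obtain B A r c where p: "p = (B, A)" "B \<in> carrier_mat r c" "A \<in> carrier_mat r n"
    using assms by (rule mat_pairsE)
  have "1\<^sub>m r * B = B * 1\<^sub>m c \<and> 1\<^sub>m r * A = A + B * 0\<^sub>m c n"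
    using p by (simp add: mult_one_mat_left mult_one_mat_right)
  then show ?thesis
    unfolding p(1) pair_le_iff[OF p(2,3) p(2,3)]
    by (intro bexI[of _ "1\<^sub>m r"] bexI[of _ "1\<^sub>m c"] bexI[of _ "0\<^sub>m c n"]) auto
qed

text \<open>
  From \<open>U B = B' V\<close>, \<open>U A = A' + B' G\<close> and the primed analogues for the second relation,
  \<open>U' U A = U' A' + U' B' G = A'' + B'' G' + B'' V' G\<close>, so that the matrices of the composite are
  \<open>U' U\<close>, \<open>V' V\<close> and \<open>G' + V' G\<close>.
\<close>

lemma pair_le_trans:
  fixes p :: "'a::{ring, monoid_mult} mat \<times> 'a mat"
  assumes "(p, q) \<in> pair_le n" "(q, s) \<in> pair_le n"
  shows "(p, s) \<in> pair_le n"
proof -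
  obtain B A r c where p: "p = (B, A)" "B \<in> carrier_mat r c" "A \<in> carrier_mat r n"
    using pair_le_mat_pairs(1)[OF assms(1)] by (rule mat_pairsE)
  obtain B' A' r' c' where q: "q = (B', A')" "B' \<in> carrier_mat r' c'" "A' \<in> carrier_mat r' n"
    using pair_le_mat_pairs(2)[OF assms(1)] by (rule mat_pairsE)
  obtain B'' A'' r'' c'' where s: "s = (B'', A'')" "B'' \<in> carrier_mat r'' c''" "A'' \<in> carrier_mat r'' n"
    using pair_le_mat_pairs(2)[OF assms(2)] by (rule mat_pairsE)
  obtain U V G where 1: "U \<in> carrier_mat r' r" "V \<in> carrier_mat c' c" "G \<in> carrier_mat c' n"
      "U * B = B' * V" "U * A = A' + B' * G"
    using assms(1) unfolding p(1) q(1) pair_le_iff[OF p(2,3) q(2,3)] by blast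
  obtain U' V' G' where 2: "U' \<in> carrier_mat r'' r'" "V' \<in> carrier_mat c'' c'" "G' \<in> carrier_mat c'' n"
      "U' * B' = B'' * V'" "U' * A' = A'' + B'' * G'"
    using assms(2) unfolding q(1) s(1) pair_le_iff[OF q(2,3) s(2,3)] by blast
  have "U' * U * B = U' * (B' * V)"
    using assoc_mult_mat[OF 2(1) 1(1) p(2)] 1(4) by simp
  also have "\<dots> = B'' * V' * V"
    using assoc_mult_mat[OF 2(1) q(2) 1(2)] 2(4) by simp
  also have "\<dots> = B'' * (V' * V)"
    using assoc_mult_mat[OF s(2) 2(2) 1(2)] .
  finally have B: "U' * U * B = B'' * (V' * V)" .
  have "U' * U * A = U' * (A' + B' * G)"
    using assoc_mult_mat[OF 2(1) 1(1) p(3)] 1(5) by simp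
  also have "\<dots> = U' * A' + U' * (B' * G)"
    by (rule mult_add_distrib_mat[OF 2(1) q(3)]) (use q 1 in simp)
  also have "U' * (B' * G) = B'' * (V' * G)"
    using assoc_mult_mat[OF 2(1) q(2) 1(3)] assoc_mult_mat[OF s(2) 2(2) 1(3)] 2(4) by simp
  also have "U' * A' + B'' * (V' * G) = A'' + (B'' * G' + B'' * (V' * G))"
    unfolding 2(5) by (rule assoc_add_mat[of _ r'' n]) (use s 1 2 in auto)
  also have "B'' * G' + B'' * (V' * G) = B'' * (G' + V' * G)"
    by (rule mult_add_distrib_mat[OF s(2) 2(3), symmetric]) (use 1 2 in simp)
  finally have "U' * U * A = A'' + B'' * (G' + V' * G)" .
  with B show ?thesis
    unfolding p(1) s(1) pair_le_iff[OF p(2,3) s(2,3)]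
    using 1(1-3) 2(1-3) by (intro bexI[of _ "U' * U"] bexI[of _ "V' * V"] bexI[of _ "G' + V' * G"]) auto
qed

section \<open>Duality reverses and reflects the pre-order\<close>

lemma dual_pair_transpose_opp:
  fixes A :: "'a::{ring, monoid_mult} mat"
  assumes "B \<in> carrier_mat r c" "A \<in> carrier_mat r n"
  shows "dual_pair n (B, A) = (transpose_opp (B \<oplus>\<^sub>c A), transpose_opp (0\<^sub>m n c \<oplus>\<^sub>c 1\<^sub>m n))"
  using assms
  by (simp add: transpose_opp_append_cols[of _ r c _ n] transpose_opp_append_cols[of _ n c _ n])

lemma dual_pair_mat_pairs:
  fixes p :: "'a::{ring, monoid_mult} mat \<times> 'a mat"
  assumes "p \<in> mat_pairs n"
  shows "dual_pair n p \<in> mat_pairs n"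
proof -
  obtain B A r c where p: "p = (B, A)" "B \<in> carrier_mat r c" "A \<in> carrier_mat r n"
    using assms by (rule mat_pairsE)
  have "B \<oplus>\<^sub>c A \<in> carrier_mat r (c + n)" "0\<^sub>m n c \<oplus>\<^sub>c 1\<^sub>m n \<in> carrier_mat n (c + n)"
    using p by (auto intro: append_cols_carrier)
  then show ?thesis
    unfolding p(1) dual_pair_transpose_opp[OF p(2,3)]
    by (intro mat_pairsI[of _ "c + n" r]) simp_all
qed

text \<open>
  Transposition turns left multiplication over the opposite ring into right multiplication over the
  ring. The matrices \<open>X\<close>, \<open>Y\<close>, \<open>Z\<close> are the transposes of \<open>U\<close>, \<open>V\<close>, \<open>G\<close>
  in the definition of the pre-order.
\<close>

lemma pair_le_transpose_opp_iff:
  fixes M :: "'a::{ring, monoid_mult} mat"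
  assumes M: "M \<in> carrier_mat r m" "N \<in> carrier_mat n m"
    and M': "M' \<in> carrier_mat r' m'" "N' \<in> carrier_mat n m'"
  shows "((transpose_opp M', transpose_opp N'), (transpose_opp M, transpose_opp N)) \<in> pair_le n \<longleftrightarrow>
    (\<exists>X \<in> carrier_mat m' m. \<exists>Y \<in> carrier_mat r' r. \<exists>Z \<in> carrier_mat n r.
      M' * X = Y * M \<and> N' * X = N + Z * M)"
proof -
  have T: "transpose_opp M \<in> carrier_mat m r" "transpose_opp N \<in> carrier_mat m n"
    "transpose_opp M' \<in> carrier_mat m' r'" "transpose_opp N' \<in> carrier_mat m' n"
    using assms by auto
  have "transpose_opp X * transpose_opp M' = transpose_opp M * transpose_opp Y \<longleftrightarrow> M' * X = Y * M"
    if "X \<in> carrier_mat m' m" "Y \<in> carrier_mat r' r" for X Y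
    using that assms
    by (simp flip: transpose_opp_mult[of _ r' m' _ m] transpose_opp_mult[of _ r' r _ m])
  moreover have "transpose_opp X * transpose_opp N' =
      transpose_opp N + transpose_opp M * transpose_opp Z \<longleftrightarrow> N' * X = N + Z * M"
    if "X \<in> carrier_mat m' m" "Z \<in> carrier_mat n r" for X Z
    using that assms
    by (simp flip: transpose_opp_mult[of _ n m' _ m] transpose_opp_mult[of _ n r _ m]
        transpose_opp_add[of _ n m])
  ultimately show ?thesis
    unfolding pair_le_iff[OF T(3,4,1,2)] bex_transpose_opp by (auto intro!: bex_cong)
qed

text \<open>
  The product with \<open>(0 I)\<close> reads off the lower blocks of \<open>X\<close>, so the second equation for
  the duals can be solved for them; substituting the result into the first equation leaves the two
  equations of the original relation.
\<close>

lemma dual_pair_le_iff: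
  fixes p q :: "'a::{ring, monoid_mult} mat \<times> 'a mat"
  assumes "p \<in> mat_pairs n" "q \<in> mat_pairs n"
  shows "(dual_pair n q, dual_pair n p) \<in> pair_le n \<longleftrightarrow> (p, q) \<in> pair_le n"
proof -
  obtain B A r c where p: "p = (B, A)" and BA: "B \<in> carrier_mat r c" "A \<in> carrier_mat r n"
    using assms(1) by (rule mat_pairsE)
  obtain B' A' r' c' where q: "q = (B', A')" and BA': "B' \<in> carrier_mat r' c'" "A' \<in> carrier_mat r' n"
    using assms(2) by (rule mat_pairsE)
  have dual: "(dual_pair n q, dual_pair n p) \<in> pair_le n \<longleftrightarrow>
    (\<exists>X \<in> carrier_mat (c' + n) (c + n). \<exists>Y \<in> carrier_mat r' r. \<exists>Z \<in> carrier_mat n r.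
      (B' \<oplus>\<^sub>c A') * X = Y * (B \<oplus>\<^sub>c A) \<and>
      (0\<^sub>m n c' \<oplus>\<^sub>c 1\<^sub>m n) * X = (0\<^sub>m n c \<oplus>\<^sub>c 1\<^sub>m n) + Z * (B \<oplus>\<^sub>c A))"
    unfolding p q dual_pair_transpose_opp[OF BA] dual_pair_transpose_opp[OF BA']
    by (rule pair_le_transpose_opp_iff) (use BA BA' in \<open>auto intro: append_cols_carrier\<close>)
  have blocks: "(B' \<oplus>\<^sub>c A') * four_block_mat P Q S T = Y * (B \<oplus>\<^sub>c A) \<and>
      (0\<^sub>m n c' \<oplus>\<^sub>c 1\<^sub>m n) * four_block_mat P Q S T = (0\<^sub>m n c \<oplus>\<^sub>c 1\<^sub>m n) + Z * (B \<oplus>\<^sub>c A) \<longleftrightarrow>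
      B' * P + A' * S = Y * B \<and> B' * Q + A' * T = Y * A \<and> S = Z * B \<and> T = 1\<^sub>m n + Z * A"
    if XYZ: "P \<in> carrier_mat c' c" "Q \<in> carrier_mat c' n" "S \<in> carrier_mat n c" "T \<in> carrier_mat n n"
      "Y \<in> carrier_mat r' r" "Z \<in> carrier_mat n r" for P Q S T Y Z
  proof -
    have "(B' \<oplus>\<^sub>c A') * four_block_mat P Q S T = (B' * P + A' * S) \<oplus>\<^sub>c (B' * Q + A' * T)"
      by (rule append_cols_mult_four_block[OF BA' XYZ(1-4)])
    moreover have "(0\<^sub>m n c' \<oplus>\<^sub>c 1\<^sub>m n) * four_block_mat P Q S T =
        (0\<^sub>m n c' * P + 1\<^sub>m n * S) \<oplus>\<^sub>c (0\<^sub>m n c' * Q + 1\<^sub>m n * T)"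
      by (rule append_cols_mult_four_block[OF zero_carrier_mat one_carrier_mat XYZ(1-4)])
    then have "(0\<^sub>m n c' \<oplus>\<^sub>c 1\<^sub>m n) * four_block_mat P Q S T = S \<oplus>\<^sub>c T"
      using XYZ by (simp add: mult_one_mat_left)
    moreover have "Y * (B \<oplus>\<^sub>c A) = Y * B \<oplus>\<^sub>c Y * A" "Z * (B \<oplus>\<^sub>c A) = Z * B \<oplus>\<^sub>c Z * A"
      by (rule mult_append_cols[OF XYZ(5) BA], rule mult_append_cols[OF XYZ(6) BA])
    moreover have "(0\<^sub>m n c \<oplus>\<^sub>c 1\<^sub>m n) + (Z * B \<oplus>\<^sub>c Z * A) = Z * B \<oplus>\<^sub>c (1\<^sub>m n + Z * A)"
      by (subst append_cols_add[of _ n c _ n]) (use BA XYZ in auto)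
    moreover have "(B' * P + A' * S) \<oplus>\<^sub>c (B' * Q + A' * T) = Y * B \<oplus>\<^sub>c Y * A \<longleftrightarrow>
        B' * P + A' * S = Y * B \<and> B' * Q + A' * T = Y * A"
      by (rule append_cols_inject[of _ r' c _ n]) (use BA BA' XYZ in auto)
    moreover have "S \<oplus>\<^sub>c T = Z * B \<oplus>\<^sub>c (1\<^sub>m n + Z * A) \<longleftrightarrow> S = Z * B \<and> T = 1\<^sub>m n + Z * A"
      by (rule append_cols_inject[of _ n c _ n]) (use BA BA' XYZ in auto)
    ultimately show ?thesis by simp
  qed
  show ?thesis
  proof
    assume "(p, q) \<in> pair_le n"
    then obtain U V G where UVG: "U \<in> carrier_mat r' r" "V \<in> carrier_mat c' c" "G \<in> carrier_mat c' n"
        "U * B = B' * V" "U * A = A' + B' * G"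
      unfolding p q pair_le_iff[OF BA BA'] by blast
    have "B' * V + A' * 0\<^sub>m n c = U * B" "B' * G + A' * 1\<^sub>m n = U * A"
        "0\<^sub>m n c = 0\<^sub>m n r * B" "1\<^sub>m n = 1\<^sub>m n + 0\<^sub>m n r * A"
      using UVG BA BA' by (simp_all add: mult_one_mat_right comm_add_mat[of _ r' n])
    then have "(B' \<oplus>\<^sub>c A') * four_block_mat V G (0\<^sub>m n c) (1\<^sub>m n) = U * (B \<oplus>\<^sub>c A) \<and>
        (0\<^sub>m n c' \<oplus>\<^sub>c 1\<^sub>m n) * four_block_mat V G (0\<^sub>m n c) (1\<^sub>m n) =
          (0\<^sub>m n c \<oplus>\<^sub>c 1\<^sub>m n) + 0\<^sub>m n r * (B \<oplus>\<^sub>c A)"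
      by (intro blocks[OF UVG(2,3) zero_carrier_mat one_carrier_mat UVG(1) zero_carrier_mat,
          THEN iffD2] conjI)
    moreover have "four_block_mat V G (0\<^sub>m n c) (1\<^sub>m n) \<in> carrier_mat (c' + n) (c + n)"
      using UVG(2) by simp
    ultimately show "(dual_pair n q, dual_pair n p) \<in> pair_le n"
      unfolding dual using UVG(1) zero_carrier_mat by blast
  next
    assume "(dual_pair n q, dual_pair n p) \<in> pair_le n"
    then obtain X Y Z where XYZ: "X \<in> carrier_mat (c' + n) (c + n)" "Y \<in> carrier_mat r' r"
        "Z \<in> carrier_mat n r" "(B' \<oplus>\<^sub>c A') * X = Y * (B \<oplus>\<^sub>c A)"
        "(0\<^sub>m n c' \<oplus>\<^sub>c 1\<^sub>m n) * X = (0\<^sub>m n c \<oplus>\<^sub>c 1\<^sub>m n) + Z * (B \<oplus>\<^sub>c A)"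
      unfolding dual by blast
    obtain P Q S T where "split_block X c' c = (P, Q, S, T)"
      by (cases "split_block X c' c")
    note PQST = split_block[OF this, of n n]
    have X: "X = four_block_mat P Q S T" and
      car: "P \<in> carrier_mat c' c" "Q \<in> carrier_mat c' n" "S \<in> carrier_mat n c" "T \<in> carrier_mat n n"
      using PQST XYZ(1) by auto
    have eqs: "B' * P + A' * (Z * B) = Y * B" "B' * Q + A' * (1\<^sub>m n + Z * A) = Y * A"
      using blocks[OF car XYZ(2,3)] XYZ(4,5) unfolding X by auto
    \<comment> \<open>Subtracting \<open>A' Z\<close> cancels the terms \<open>A' Z B\<close> and \<open>A' Z A\<close> of \<open>eqs\<close>.\<close>
    define U where "U = Y - A' * Z"
    have U: "U \<in> carrier_mat r' r" using XYZ BA' by (auto simp: U_def)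
    have "U * B = Y * B - A' * (Z * B)"
      unfolding U_def using XYZ BA BA'
      by (simp add: minus_mult_distrib_mat[of _ r' r _ _ c] assoc_mult_mat[of _ r' n _ r])
    also have "\<dots> = B' * P"
      unfolding eqs(1)[symmetric] using XYZ BA BA' car by (intro eq_matI) auto
    finally have UB: "U * B = B' * P" .
    have "U * A = Y * A - A' * (Z * A)"
      unfolding U_def using XYZ BA BA'
      by (simp add: minus_mult_distrib_mat[of _ r' r _ _ n] assoc_mult_mat[of _ r' n _ r])
    also have "Y * A = B' * Q + (A' + A' * (Z * A))"
      unfolding eqs(2)[symmetric] using XYZ BA BA'
      by (simp add: mult_add_distrib_mat[of _ r' n _ n] mult_one_mat_right)
    also have "B' * Q + (A' + A' * (Z * A)) - A' * (Z * A) = A' + B' * Q"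
      using XYZ BA BA' car by (intro eq_matI) auto
    finally show "(p, q) \<in> pair_le n"
      unfolding p q pair_le_iff[OF BA BA'] using U UB car by blast
  qed
qed

section \<open>Every pair is equivalent to a dual\<close>

text \<open>
  A pair \<open>(B | A)\<close> may be enlarged by the columns of \<open>A\<close> on the left-hand side, provided that
  \<open>n\<close> new rows \<open>(0 I | I)\<close> compensate for them. Think of a pair as the
  condition \<open>\<exists>y. B y = A x\<close> on tuples \<open>x\<close> from a left module: the enlarged pair says that \<open>B y + A z = 0\<close>
  and \<open>z = x\<close> for some \<open>y\<close> and \<open>z\<close>, which is the same condition with \<open>- y\<close> for \<open>y\<close>.
  This change of sign is the source of the entries \<open>- 1\<close> in the matrices below.
\<close>

lemma four_block_pair_equiv:
  fixes A :: "'a::{ring, monoid_mult} mat"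
  assumes BA: "B \<in> carrier_mat r c" "A \<in> carrier_mat r n"
  shows "((four_block_mat B A (0\<^sub>m n c) (1\<^sub>m n), 0\<^sub>m r n @\<^sub>r 1\<^sub>m n), (B, A)) \<in> pair_equiv n"
proof -
  let ?M = "four_block_mat B A (0\<^sub>m n c) (1\<^sub>m n)"
  let ?E = "0\<^sub>m r n @\<^sub>r 1\<^sub>m n"
  have ME: "?M \<in> carrier_mat (r + n) (c + n)" "?E \<in> carrier_mat (r + n) n"
    using BA by auto
  have "((?M, ?E), (B, A)) \<in> pair_le n"
  proof -
    let ?U = "- 1\<^sub>m r \<oplus>\<^sub>c A" and ?V = "- 1\<^sub>m c \<oplus>\<^sub>c 0\<^sub>m c n"
    have "?U * ?M = (- 1\<^sub>m r * B + A * 0\<^sub>m n c) \<oplus>\<^sub>c (- 1\<^sub>m r * A + A * 1\<^sub>m n)"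
      by (rule append_cols_mult_four_block) (use BA in auto)
    also have "\<dots> = - B \<oplus>\<^sub>c 0\<^sub>m r n"
      using BA by (simp add: mult_one_mat_left mult_one_mat_right)
    also have "\<dots> = B * ?V"
      using BA by (simp add: mult_append_cols[of _ r c _ c _ n] mult_one_mat_right)
    finally have UM: "?U * ?M = B * ?V" .
    have "?U * ?E = A + B * 0\<^sub>m c n"
      using BA by (simp add: append_cols_mult_append_rows[of _ r r _ n _ n] mult_one_mat_right)
    then show ?thesis
      unfolding pair_le_iff[OF ME BA] using UM BA
      by (intro bexI[of _ ?U] bexI[of _ ?V] bexI[of _ "0\<^sub>m c n"]) (auto intro: append_cols_carrier)
  qed
  moreover have "((B, A), (?M, ?E)) \<in> pair_le n"
  proof -
    let ?U = "- 1\<^sub>m r @\<^sub>r 0\<^sub>m n r" and ?V = "- 1\<^sub>m c @\<^sub>r 0\<^sub>m n c" and ?G = "0\<^sub>m c n @\<^sub>r - 1\<^sub>m n"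
    have "?U * B = - B @\<^sub>r 0\<^sub>m n c"
      using BA by (simp add: append_rows_mult[of _ r r _ n _ c] mult_one_mat_left)
    also have "0\<^sub>m n c = - (0\<^sub>m n c :: 'a mat)"
      by (intro eq_matI) auto
    also have "- B @\<^sub>r - 0\<^sub>m n c = (B * - 1\<^sub>m c + A * 0\<^sub>m n c) @\<^sub>r (0\<^sub>m n c * - 1\<^sub>m c + 1\<^sub>m n * 0\<^sub>m n c)"
      using BA by (simp add: mult_one_mat_right)
    also have "\<dots> = ?M * ?V"
      by (rule four_block_mult_append_rows[symmetric]) (use BA in auto)
    finally have UB: "?U * B = ?M * ?V" .
    have "?M * ?G = (B * 0\<^sub>m c n + A * - 1\<^sub>m n) @\<^sub>r (0\<^sub>m n c * 0\<^sub>m c n + 1\<^sub>m n * - 1\<^sub>m n)"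
      by (rule four_block_mult_append_rows) (use BA in auto)
    also have "\<dots> = - A @\<^sub>r - 1\<^sub>m n"
      using BA by (simp add: mult_one_mat_right[of _ r n] mult_one_mat_right[of _ n n])
    finally have MG: "?M * ?G = - A @\<^sub>r - 1\<^sub>m n" .
    have "1\<^sub>m n + - 1\<^sub>m n = (0\<^sub>m n n :: 'a mat)"
      by (intro eq_matI) auto
    then have "?E + ?M * ?G = - A @\<^sub>r 0\<^sub>m n n"
      unfolding MG using BA by (simp add: append_rows_add[of _ r n _ n])
    also have "\<dots> = ?U * A"
      using BA by (simp add: append_rows_mult[of _ r r _ n _ n] mult_one_mat_left)
    finally show ?thesis
      unfolding pair_le_iff[OF BA ME] using UB BA
      by (intro bexI[of _ ?U] bexI[of _ ?V] bexI[of _ ?G]) auto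
  qed
  ultimately show ?thesis
    by (simp add: pair_equiv_def)
qed

text \<open>
  The preimage is the dual construction applied in the other direction, from the opposite ring to
  the ring, so that its dual is a double dual of the given pair.
\<close>

lemma ex_dual_pair_equiv:
  fixes q :: "'a::{ring, monoid_mult} opp mat \<times> 'a opp mat"
  assumes "q \<in> mat_pairs n"
  shows "\<exists>p \<in> mat_pairs n. (dual_pair n p, q) \<in> pair_equiv n"
proof -
  obtain D C :: "'a mat" and r c where q: "q = (transpose_opp D, transpose_opp C)"
    and DC: "D \<in> carrier_mat c r" "C \<in> carrier_mat n r"
  proof -
    obtain D' C' r c where q: "q = (D', C')" "D' \<in> carrier_mat r c" "C' \<in> carrier_mat r n"
      using assms by (rule mat_pairsE)
    obtain D C where "D' = transpose_opp D" "C' = transpose_opp C"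
      using transpose_opp_surj by blast
    with q that show ?thesis by simp
  qed
  let ?B = "D @\<^sub>r C" and ?A = "0\<^sub>m c n @\<^sub>r (1\<^sub>m n :: 'a mat)"
  have "dual_pair n (?B, ?A) =
      (four_block_mat (transpose_opp D) (transpose_opp C) (0\<^sub>m n c) (1\<^sub>m n), 0\<^sub>m r n @\<^sub>r 1\<^sub>m n)"
  proof -
    have "transpose_opp ?B @\<^sub>r transpose_opp ?A =
        (transpose_opp D \<oplus>\<^sub>c transpose_opp C) @\<^sub>r (0\<^sub>m n c \<oplus>\<^sub>c 1\<^sub>m n)"
      using DC by (simp add: transpose_opp_append_rows[of _ c r _ n] transpose_opp_append_rows[of _ c n _ n])
    also have "\<dots> = four_block_mat (transpose_opp D) (transpose_opp C) (0\<^sub>m n c) (1\<^sub>m n)"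
      by (rule append_cols_append_rows) (use DC in auto)
    finally show ?thesis using DC by (simp add: append_rows_def)
  qed
  moreover have "(?B, ?A) \<in> mat_pairs n"
    using DC by (intro mat_pairsI[of _ "c + n" r]) auto
  ultimately show ?thesis
    unfolding q using four_block_pair_equiv[of "transpose_opp D" r c "transpose_opp C" n] DC
    by (intro bexI[of _ "(?B, ?A)"]) simp_all
qed

section \<open>The induced anti-isomorphism\<close>

lemma equiv_pair_equiv: "equiv (mat_pairs n) (pair_equiv n)"
  by (auto simp: equiv_def refl_on_def sym_def trans_def pair_equiv_def
      intro: pair_le_refl pair_le_trans dest: pair_le_mat_pairs)

lemma pair_class_eq_iff:
  assumes "p \<in> mat_pairs n" "q \<in> mat_pairs n"
  shows "pair_class n p = pair_class n q \<longleftrightarrow> (p, q) \<in> pair_equiv n"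
  unfolding pair_class_def using assms by (rule eq_equiv_class_iff[OF equiv_pair_equiv])

lemma L_eq_image: "L n = pair_class n ` mat_pairs n"
  by (auto simp: L_def quotient_def pair_class_def)

lemma L_le_pair_class_iff:
  assumes "p \<in> mat_pairs n" "q \<in> mat_pairs n"
  shows "(pair_class n p, pair_class n q) \<in> L_le n \<longleftrightarrow> (p, q) \<in> pair_le n"
proof
  assume "(pair_class n p, pair_class n q) \<in> L_le n"
  then show "(p, q) \<in> pair_le n"
    by (auto simp: L_le_def pair_class_def pair_equiv_def intro: pair_le_trans)
next
  assume "(p, q) \<in> pair_le n"
  moreover have "p \<in> pair_class n p" "q \<in> pair_class n q"
    using assms by (auto simp: pair_class_def pair_equiv_def pair_le_refl)
  ultimately show "(pair_class n p, pair_class n q) \<in> L_le n"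
    using assms by (auto simp: L_le_def L_eq_image)
qed

lemma partial_order_on_L: "partial_order_on (L n) (L_le n)"
  unfolding partial_order_on_def preorder_on_def
proof (intro conjI)
  show "L_le n \<subseteq> L n \<times> L n" by (auto simp: L_le_def)
  show "refl_on (L n) (L_le n)"
    by (auto simp: refl_on_def L_eq_image L_le_pair_class_iff pair_le_refl)
  show "trans (L_le n)"
  proof (rule transI)
    fix X Y Z assume *: "(X, Y) \<in> L_le n" "(Y, Z) \<in> L_le n"
    then have "X \<in> L n" "Y \<in> L n" "Z \<in> L n" by (auto simp: L_le_def)
    with * show "(X, Z) \<in> L_le n"
      by (auto simp: L_eq_image L_le_pair_class_iff intro: pair_le_trans)
  qed
  show "antisym (L_le n)"
  proof (rule antisymI)
    fix X Y assume *: "(X, Y) \<in> L_le n" "(Y, X) \<in> L_le n"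
    then have "X \<in> L n" "Y \<in> L n" by (auto simp: L_le_def)
    then obtain p q where pq: "p \<in> mat_pairs n" "q \<in> mat_pairs n"
      and XY: "X = pair_class n p" "Y = pair_class n q"
      by (auto simp: L_eq_image)
    show "X = Y"
      using * unfolding XY L_le_pair_class_iff[OF pq] L_le_pair_class_iff[OF pq(2,1)]
        pair_class_eq_iff[OF pq] by (simp add: pair_equiv_def)
  qed
qed

lemma dual_pair_equiv_iff:
  assumes "p \<in> mat_pairs n" "q \<in> mat_pairs n"
  shows "(dual_pair n p, dual_pair n q) \<in> pair_equiv n \<longleftrightarrow> (p, q) \<in> pair_equiv n"
  using assms by (auto simp: pair_equiv_def dual_pair_le_iff)

lemma dual_pair_respects:
  "(\<lambda>p. pair_class n (dual_pair n p)) respects (pair_equiv n)"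
proof (rule congruentI)
  fix p q :: "'a::{ring, monoid_mult} mat \<times> 'a mat"
  assume pq: "(p, q) \<in> pair_equiv n"
  then have "p \<in> mat_pairs n" "q \<in> mat_pairs n"
    by (auto simp: pair_equiv_def dest: pair_le_mat_pairs)
  with pq show "pair_class n (dual_pair n p) = pair_class n (dual_pair n q)"
    by (simp add: pair_class_eq_iff dual_pair_mat_pairs dual_pair_equiv_iff)
qed

lemma dual_class_pair_class:
  assumes "p \<in> mat_pairs n"
  shows "dual_class n (pair_class n p) = pair_class n (dual_pair n p)"
  unfolding dual_class_def pair_class_def[of n p]
  by (rule UN_equiv_class[OF equiv_pair_equiv dual_pair_respects assms])

lemma L_le_dual_class_iff:
  assumes "X \<in> L n" "Y \<in> L n"
  shows "(dual_class n Y, dual_class n X) \<in> L_le n \<longleftrightarrow> (X, Y) \<in> L_le n"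
  using assms
  by (auto simp: L_eq_image dual_class_pair_class L_le_pair_class_iff dual_pair_mat_pairs
      dual_pair_le_iff simp del: dual_pair.simps)

lemma dual_class_image:
  "dual_class n ` (L n :: ('a::{ring, monoid_mult} mat \<times> 'a mat) set set) = L n"
proof
  show "dual_class n ` (L n :: ('a mat \<times> 'a mat) set set) \<subseteq> L n"
    by (auto simp: L_eq_image dual_class_pair_class dual_pair_mat_pairs simp del: dual_pair.simps)
  show "L n \<subseteq> dual_class n ` (L n :: ('a mat \<times> 'a mat) set set)"
  proof
    fix Y :: "('a opp mat \<times> 'a opp mat) set" assume "Y \<in> L n"
    then obtain q where q: "q \<in> mat_pairs n" "Y = pair_class n q" by (auto simp: L_eq_image)
    then obtain p :: "'a mat \<times> 'a mat" where "p \<in> mat_pairs n" "(dual_pair n p, q) \<in> pair_equiv n"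
      using ex_dual_pair_equiv by blast
    then have "p \<in> mat_pairs n" "Y = dual_class n (pair_class n p)"
      using q by (simp_all add: dual_class_pair_class pair_class_eq_iff[symmetric] dual_pair_mat_pairs)
    then show "Y \<in> dual_class n ` (L n :: ('a mat \<times> 'a mat) set set)" by (simp add: L_eq_image)
  qed
qed

text \<open>
  A surjection that reverses and reflects the order is injective by antisymmetry, and its inverse
  reverses the order because the map reflects it.
\<close>

lemma order_anti_isomorphismI:
  assumes "partial_order_on P r" "partial_order_on Q s" "f ` P = Q"
    and iff: "\<And>x y. x \<in> P \<Longrightarrow> y \<in> P \<Longrightarrow> (f y, f x) \<in> s \<longleftrightarrow> (x, y) \<in> r"
  shows "order_anti_isomorphism P r Q s f"
proof -
  have "inj_on f P"
  proof (rule inj_onI)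
    fix x y assume xy: "x \<in> P" "y \<in> P" "f x = f y"
    have "(f x, f x) \<in> s"
      using assms(2,3) xy by (auto simp: partial_order_on_def preorder_on_def refl_on_def)
    then have "(x, y) \<in> r" "(y, x) \<in> r"
      using iff[of x y] iff[of y x] xy by auto
    then show "x = y"
      using assms(1) by (auto simp: partial_order_on_def dest: antisymD)
  qed
  then have bij: "bij_betw f P Q" using assms(3) by (simp add: bij_betw_def)
  moreover have "(inv_into P f v, inv_into P f u) \<in> r" if "u \<in> Q" "v \<in> Q" "(u, v) \<in> s" for u v
    using that iff[of "inv_into P f v" "inv_into P f u"] assms(3)
    by (auto simp: f_inv_into_f inv_into_into)
  ultimately show ?thesis
    using assms by (auto simp: order_anti_isomorphism_def)
qed

theorem corollary15:
  fixes n :: nat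
  assumes "n \<ge> 1"
  shows "((\<lambda>p :: 'a::{ring, monoid_mult} mat \<times> 'a mat. pair_class n (dual_pair n p))
            respects (pair_equiv n)) \<and>
         (\<forall>(B :: 'a mat) A. (B, A) \<in> mat_pairs n \<longrightarrow>
            dual_class n (pair_class n (B, A)) = pair_class n (dual_pair n (B, A))) \<and>
         order_anti_isomorphism (L n) (L_le n) (L n) (L_le n)
           (dual_class n :: ('a mat \<times> 'a mat) set \<Rightarrow> ('a opp mat \<times> 'a opp mat) set)"
  using dual_pair_respects dual_class_pair_class
    order_anti_isomorphismI[OF partial_order_on_L partial_order_on_L dual_class_image
      L_le_dual_class_iff]
  by blast

end
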